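(* Let $F=(f_1,\ldots,f_m)^\top:\mathbb{R}^n\to\mathbb{R}^m$ be continuously differentiable, let $s\in\mathbb{N}$ with $1\le s<n$, and let $\Omega=\{x\in\mathbb{R}^n\mid \|x\|_0\le s\}$. Let $L>0$ and let $\bar x\in\Omega$ be an $L$-stationary point for the problem $\min_{x\in\Omega}F(x)$. Then $\bar x$ is Pareto-stationary for the problem $\min_{x\in\Omega}F(x)$.
   Context: $\|x\|_0$ denotes the number of nonzero components of $x$, and $\|\cdot\|$ is the Euclidean norm. $L$-stationarity: for $L>0$ and $\bar x\in\Omega$ let $\mathcal{D}_L(\bar x)=\{v\in\mathbb{R}^n\mid \bar x+v\in\Omega\}$ and $$\theta_L(\bar x)=\min_{d\in\mathcal{D}_L(\bar x)}\ \max_{j=1,\ldots,m}\nabla f_j(\bar x)^\top d+\frac{L}{2}\|d\|^2 .$$ The point $\bar x\in\Omega$ is $L$-stationary if $\theta_L(\bar x)=0$. Pareto-stationarity: for $\bar x\in\Omega$ let $\mathcal{D}(\bar x)=\{v\in\mathbb{R}^n\mid \exists\,\bar t>0:\ \bar x+tv\in\Omega\ \ \forall t\in[0,\bar t\,]\}$ be the set of feasible directions at $\bar x$; equivalently, $\mathcal{D}(\bar x)=\{v\in\mathbb{R}^n\mid \|v_{S_0(\bar x)}\|_0\le s-\|\bar x\|_0\}$, where $S_0(\bar x)=\{i\mid \bar x_i=0\}$ and $v_{S_0(\bar x)}$ is the corresponding subvector of $v$. The point $\bar x\in\Omega$ is Pareto-stationary if $$\theta(\bar x)=\min_{d\in\mathcal{D}(\bar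 x)}\ \max_{j=1,\ldots,m}\nabla f_j(\bar x)^\top d+\frac12\|d\|^2=0 .$$ *)

theory Defs
  imports "HOL-Analysis.Analysis"
begin

definition l0_norm :: "real ^ 'n \<Rightarrow> nat" where
  "l0_norm x = card {i. x $ i \<noteq> 0}"

definition sparse_set :: "nat \<Rightarrow> (real ^ 'n) set" where
  "sparse_set s = {x. l0_norm x \<le> s}"

(* The derivative is continuous with respect to the operator norm. *)
definition continuously_differentiable ::
    "('a::real_normed_vector \<Rightarrow> 'b::real_normed_vector) \<Rightarrow> bool" where
  "continuously_differentiable f \<longleftrightarrow>
     (\<exists>f' :: 'a \<Rightarrow> 'a \<Rightarrow>\<^sub>L 'b.
        (\<forall>x. (f has_derivative blinfun_apply (f' x)) (at x)) \<and> continuous_on UNIV f')"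

(* Unspecified where f is not differentiable. *)
definition gradient :: "('a::real_inner \<Rightarrow> real) \<Rightarrow> 'a \<Rightarrow> 'a" where
  "gradient f x = (THE g. GDERIV f x :> g)"

definition model :: "(real ^ 'n \<Rightarrow> real ^ 'm) \<Rightarrow> real \<Rightarrow> real ^ 'n \<Rightarrow> real ^ 'n \<Rightarrow> real" where
  "model F c x d = (MAX j. gradient (\<lambda>y. F y $ j) x \<bullet> d) + c / 2 * (norm d)\<^sup>2"

definition displacements :: "'a::real_vector set \<Rightarrow> 'a \<Rightarrow> 'a set" where
  "displacements \<Omega> x = {v. x + v \<in> \<Omega>}"

definition feasible_directions :: "'a::real_vector set \<Rightarrow> 'a \<Rightarrow> 'a set" where
  "feasible_directions \<Omega> x = {v. \<exists>t'>0. \<forall>t\<in>{0..t'}. x + t *\<^sub>R v \<in> \<Omega>}"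

(* The two infima below are minima when \<Omega> is a sparse set: see theta_L_is_min and
   theta_is_min. *)
definition theta_L ::
    "(real ^ 'n \<Rightarrow> real ^ 'm) \<Rightarrow> (real ^ 'n) set \<Rightarrow> real \<Rightarrow> real ^ 'n \<Rightarrow> real" where
  "theta_L F \<Omega> L x = (INF d\<in>displacements \<Omega> x. model F L x d)"

definition theta ::
    "(real ^ 'n \<Rightarrow> real ^ 'm) \<Rightarrow> (real ^ 'n) set \<Rightarrow> real ^ 'n \<Rightarrow> real" where
  "theta F \<Omega> x = (INF d\<in>feasible_directions \<Omega> x. model F 1 x d)"

definition L_stationary ::
    "(real ^ 'n \<Rightarrow> real ^ 'm) \<Rightarrow> (real ^ 'n) set \<Rightarrow> real \<Rightarrow> real ^ 'n \<Rightarrow> bool" where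
  "L_stationary F \<Omega> L x \<longleftrightarrow> x \<in> \<Omega> \<and> theta_L F \<Omega> L x = 0"

definition pareto_stationary ::
    "(real ^ 'n \<Rightarrow> real ^ 'm) \<Rightarrow> (real ^ 'n) set \<Rightarrow> real ^ 'n \<Rightarrow> bool" where
  "pareto_stationary F \<Omega> x \<longleftrightarrow> x \<in> \<Omega> \<and> theta F \<Omega> x = 0"


lemma gradient_eq: "GDERIV f x :> g \<Longrightarrow> gradient f x = g"
proof -
  assume g: "GDERIV f x :> g"
  have "h = g" if "GDERIV f x :> h" for h
  proof -
    have "(\<lambda>y. y \<bullet> h) = (\<lambda>y. y \<bullet> g)"
      using has_derivative_unique g that unfolding gderiv_def by blast
    then have "(h - g) \<bullet> h = (h - g) \<bullet> g" by metis
    then have "(h - g) \<bullet> (h - g) = 0" by (simp add: inner_diff_right)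
    then show ?thesis by simp
  qed
  then show ?thesis unfolding gradient_def using g by blast
qed

lemma gderiv_gradient:
  fixes F :: "real ^ 'n \<Rightarrow> real ^ 'm"
  assumes "continuously_differentiable F"
  shows "GDERIV (\<lambda>y. F y $ j) x :> gradient (\<lambda>y. F y $ j) x"
proof -
  obtain F' where F': "(F has_derivative blinfun_apply (F' x)) (at x)"
    using assms unfolding continuously_differentiable_def by blast
  define l where "l h = blinfun_apply (F' x) h $ j" for h
  have d: "((\<lambda>y. F y $ j) has_derivative l) (at x)"
    unfolding l_def by (rule bounded_linear.has_derivative[OF bounded_linear_vec_nth F'])
  then have lin: "linear l" by (rule has_derivative_linear)
  define g where "g = adjoint l 1"
  have "l h = h \<bullet> g" for h
    using adjoint_works[OF lin, of h 1] by (simp add: g_def inner_commute)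
  then have "l = (\<lambda>h. h \<bullet> g)" by blast
  then have "GDERIV (\<lambda>y. F y $ j) x :> g" using d unfolding gderiv_def by simp
  then show ?thesis using gradient_eq by metis
qed

lemma closed_sparse_set: "closed (sparse_set s :: (real ^ 'n) set)"
proof -
  have "sparse_set s = (\<Union>I\<in>{I::'n set. card I \<le> s}. \<Inter>i\<in>-I. {x. x $ i = 0})"
  proof (intro equalityI subsetI)
    fix x :: "real ^ 'n" assume "x \<in> sparse_set s"
    then have "card {i. x $ i \<noteq> 0} \<le> s" by (simp add: sparse_set_def l0_norm_def)
    moreover have "x \<in> (\<Inter>i\<in>-{i. x $ i \<noteq> 0}. {x. x $ i = 0})" by simp
    ultimately show "x \<in> (\<Union>I\<in>{I::'n set. card I \<le> s}. \<Inter>i\<in>-I. {x. x $ i = 0})" by blast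
  next
    fix x :: "real ^ 'n"
    assume "x \<in> (\<Union>I\<in>{I::'n set. card I \<le> s}. \<Inter>i\<in>-I. {x. x $ i = 0})"
    then obtain I :: "'n set" where I: "card I \<le> s" "\<forall>i\<in>-I. x $ i = 0" by blast
    then have "{i. x $ i \<noteq> 0} \<subseteq> I" by blast
    then have "card {i. x $ i \<noteq> 0} \<le> card I" by (simp add: card_mono)
    with I show "x \<in> sparse_set s" by (simp add: sparse_set_def l0_norm_def)
  qed
  moreover have "closed (\<Inter>i\<in>-I. {x::real^'n. x $ i = 0})" for I :: "'n set"
    by (intro closed_INT ballI closed_Collect_eq continuous_intros)
  ultimately show ?thesis by (simp add: closed_UN)
qed

lemma feasible_directions_sparse_set:
  fixes x :: "real ^ 'n"
  assumes "x \<in> sparse_set s"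
  shows "feasible_directions (sparse_set s) x =
    {v. l0_norm (\<chi> i. if x $ i = 0 then v $ i else 0) \<le> s - l0_norm x}"
proof (intro equalityI subsetI)
  let ?S = "{i. x $ i \<noteq> 0}"
  {
    fix v :: "real ^ 'n"
    let ?N = "{i. x $ i = 0 \<and> v $ i \<noteq> 0}"
    have "l0_norm (\<chi> i. if x $ i = 0 then v $ i else 0) = card ?N"
      unfolding l0_norm_def by (rule arg_cong[where f = card]) auto
    moreover have "card (?S \<union> ?N) = l0_norm x + card ?N"
      unfolding l0_norm_def by (rule card_Un_disjoint) auto
    ultimately have "l0_norm (\<chi> i. if x $ i = 0 then v $ i else 0) \<le> s - l0_norm x \<longleftrightarrow>
        card (?S \<union> ?N) \<le> s"
      using assms by (auto simp: sparse_set_def)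
  } note key = this
  fix v :: "real ^ 'n"
  let ?N = "{i. x $ i = 0 \<and> v $ i \<noteq> 0}"
  {
    assume "v \<in> feasible_directions (sparse_set s) x"
    then obtain t' where t': "t' > 0" and
      mem: "\<And>t. 0 \<le> t \<Longrightarrow> t \<le> t' \<Longrightarrow> x + t *\<^sub>R v \<in> sparse_set s"
      unfolding feasible_directions_def by auto
    define T where "T = (\<lambda>i. - (x $ i) / v $ i) ` UNIV"
    have "finite T" by (simp add: T_def)
    then have "infinite ({0<..<t'} - T)" using t' by (simp add: infinite_Ioo)
    then obtain t where t: "0 < t" "t < t'" "t \<notin> T"
      by (metis Diff_iff ex_in_conv finite.emptyI greaterThanLessThan_iff)
    have nz: "(x + t *\<^sub>R v) $ i \<noteq> 0" if "i \<in> ?S \<union> ?N" for i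
    proof (cases "v $ i = 0")
      case True
      with that show ?thesis by auto
    next
      case False
      have "t \<noteq> - (x $ i) / v $ i" using t(3) unfolding T_def by blast
      with False show ?thesis by (auto simp: field_simps)
    qed
    have "card (?S \<union> ?N) \<le> card {i. (x + t *\<^sub>R v) $ i \<noteq> 0}"
      using nz by (intro card_mono) auto
    also have "\<dots> \<le> s" using mem[of t] t by (simp add: sparse_set_def l0_norm_def)
    finally show "v \<in> {v. l0_norm (\<chi> i. if x $ i = 0 then v $ i else 0) \<le> s - l0_norm x}"
      using key by simp
  next
    assume "v \<in> {v. l0_norm (\<chi> i. if x $ i = 0 then v $ i else 0) \<le> s - l0_norm x}"
    then have le: "card (?S \<union> ?N) \<le> s" using key by simp
    have "x + t *\<^sub>R v \<in> sparse_set s" for t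
    proof -
      have "{i. (x + t *\<^sub>R v) $ i \<noteq> 0} \<subseteq> ?S \<union> ?N" by auto
      then have "card {i. (x + t *\<^sub>R v) $ i \<noteq> 0} \<le> card (?S \<union> ?N)" by (simp add: card_mono)
      with le show ?thesis by (simp add: sparse_set_def l0_norm_def)
    qed
    then show "v \<in> feasible_directions (sparse_set s) x"
      unfolding feasible_directions_def using zero_less_one by blast
  }
qed

lemma continuous_on_Max_image:
  fixes f :: "'i \<Rightarrow> 'a::topological_space \<Rightarrow> real"
  assumes "finite I" "I \<noteq> {}" "\<And>i. i \<in> I \<Longrightarrow> continuous_on A (f i)"
  shows "continuous_on A (\<lambda>x. Max ((\<lambda>i. f i x) ` I))"
  using assms
proof (induction I rule: finite_ne_induct)
  case (singleton i)
  then show ?case by simp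
next
  case (insert i I)
  have "(\<lambda>x. Max ((\<lambda>i. f i x) ` insert i I)) = (\<lambda>x. max (f i x) (Max ((\<lambda>i. f i x) ` I)))"
    using insert by simp
  then show ?case using insert by (simp add: continuous_on_max)
qed

lemma model_attains_inf:
  fixes F :: "real ^ 'n \<Rightarrow> real ^ 'm"
  assumes "closed D" "0 \<in> D" "c > 0"
  shows "\<exists>d\<in>D. \<forall>e\<in>D. model F c x d \<le> model F c x e"
proof -
  define g where "g j = gradient (\<lambda>y. F y $ j) x" for j
  have m: "model F c x d = (MAX j. g j \<bullet> d) + c / 2 * (norm d)\<^sup>2" for d
    by (simp add: model_def g_def)
  have cont: "continuous_on A (model F c x)" for A
    unfolding m by (intro continuous_intros continuous_on_Max_image) auto
  have zero: "model F c x 0 = 0" by (simp add: m)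
  define k where "k = (undefined :: 'm)"
  define R where "R = 2 * norm (g k) / c"
  have R: "R \<ge> 0" using assms by (simp add: R_def)
  have "compact (D \<inter> cball 0 R)" using assms by (simp add: closed_Int_compact)
  moreover have "D \<inter> cball 0 R \<noteq> {}" using assms R by force
  ultimately obtain d where d: "d \<in> D \<inter> cball 0 R"
      "\<And>e. e \<in> D \<inter> cball 0 R \<Longrightarrow> model F c x d \<le> model F c x e"
    using continuous_attains_inf[OF _ _ cont] by meson
  have "model F c x d \<le> model F c x e" if "e \<in> D" for e
  proof (cases "norm e \<le> R")
    case True
    then show ?thesis using d that by simp
  next
    case False
    then have "2 * norm (g k) \<le> c * norm e"
      using assms by (simp add: R_def field_simps)
    then have "2 * norm (g k) * norm e \<le> c * norm e * norm e"
      by (rule mult_right_mono) simp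
    then have "norm (g k) * norm e \<le> c / 2 * (norm e)\<^sup>2"
      by (simp add: power2_eq_square field_simps)
    moreover have "- (norm (g k) * norm e) \<le> g k \<bullet> e"
      using Cauchy_Schwarz_ineq2[of "g k" e] by linarith
    moreover have "g k \<bullet> e \<le> (MAX j. g j \<bullet> e)" by simp
    ultimately have "0 \<le> model F c x e" unfolding m by linarith
    moreover have "model F c x d \<le> 0" using d(2)[of 0] assms R zero by simp
    ultimately show ?thesis by linarith
  qed
  with d show ?thesis by blast
qed

lemma INF_eq_attained:
  fixes f :: "'a \<Rightarrow> real"
  assumes "d \<in> D" "\<forall>e\<in>D. f d \<le> f e"
  shows "(INF d\<in>D. f d) = f d"
  using assms by (intro cInf_eq_minimum) auto

lemma theta_L_is_min:
  fixes F :: "real ^ 'n \<Rightarrow> real ^ 'm"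
  assumes "x \<in> sparse_set s" "L > 0"
  shows "\<exists>d\<in>displacements (sparse_set s) x. theta_L F (sparse_set s) L x = model F L x d \<and>
    (\<forall>e\<in>displacements (sparse_set s) x. model F L x d \<le> model F L x e)"
proof -
  have "displacements (sparse_set s) x = (\<lambda>v. x + v) -` sparse_set s"
    by (auto simp: displacements_def)
  then have "closed (displacements (sparse_set s) x)"
    by (simp add: closed_vimage closed_sparse_set continuous_intros)
  moreover have "0 \<in> displacements (sparse_set s) x" using assms by (simp add: displacements_def)
  ultimately show ?thesis
    unfolding theta_L_def using model_attains_inf[OF _ _ assms(2)] INF_eq_attained by metis
qed

lemma theta_is_min:
  fixes F :: "real ^ 'n \<Rightarrow> real ^ 'm"
  assumes "x \<in> sparse_set s"
  shows "\<exists>d\<in>feasible_directions (sparse_set s) x. theta F (sparse_set s) x = model F 1 x d \<and>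
    (\<forall>e\<in>feasible_directions (sparse_set s) x. model F 1 x d \<le> model F 1 x e)"
proof -
  let ?p = "\<lambda>v :: real ^ 'n. \<chi> i. if x $ i = 0 then v $ i else 0"
  have "feasible_directions (sparse_set s) x = ?p -` sparse_set (s - l0_norm x)"
    unfolding feasible_directions_sparse_set[OF assms] by (auto simp: sparse_set_def)
  moreover have "continuous_on UNIV ?p"
  proof (intro continuous_on_vec_lambda)
    fix i show "continuous_on UNIV (\<lambda>v. if x $ i = 0 then v $ i else 0)"
      by (cases "x $ i = 0") (simp_all add: continuous_intros)
  qed
  ultimately have "closed (feasible_directions (sparse_set s) x)"
    by (simp add: closed_vimage closed_sparse_set)
  moreover have "0 \<in> feasible_directions (sparse_set s) x"
    using assms by (auto simp: feasible_directions_def intro: exI[of _ 1])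
  ultimately show ?thesis
    unfolding theta_def using model_attains_inf[OF _ _ zero_less_one] INF_eq_attained by metis
qed

end

theory Submission
  imports Defs
begin

text \<open>
  A feasible direction v yields the displacements t v for all small t > 0. The max term of the
  model is positively homogeneous while its quadratic term is of order t squared, so nonnegativity
  of the model on displacements forces the max term to be nonnegative at v, whatever the
  constant of the quadratic term is.
\<close>

lemma model_0 [simp]: "model F c x 0 = 0"
  by (simp add: model_def)

text \<open>Multiplying by \<open>t\<close> \<ge> 0 preserves order, so \<open>t\<close> times the
  old maximum bounds every scaled inner product.\<close>

lemma model_scaleR_le:
  fixes F :: "real ^ 'n \<Rightarrow> real ^ 'm"
  assumes "t \<ge> 0"
  shows "model F c x (t *\<^sub>R v) \<le>
    t * (MAX j. gradient (\<lambda>y. F y $ j) x \<bullet> v) + c / 2 * t\<^sup>2 * (norm v)\<^sup>2"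
proof -
  have "(MAX j. gradient (\<lambda>y. F y $ j) x \<bullet> (t *\<^sub>R v)) \<le>
      t * (MAX j. gradient (\<lambda>y. F y $ j) x \<bullet> v)"
    using assms by (simp add: mult_left_mono)
  then show ?thesis
    unfolding model_def norm_scaleR power_mult_distrib power2_abs
    by (simp only: mult.assoc add_right_mono)
qed

text \<open>Dividing by \<open>t\<close> leaves \<open>M + b * t\<close>, which is nonnegative for
  small \<open>t\<close> > 0 and tends to \<open>M\<close> as \<open>t\<close> decreases to
  0.\<close>

lemma nonneg_if_small_multiples_nonneg:
  fixes M b :: real
  assumes "t' > 0" and nonneg: "\<And>t. 0 < t \<Longrightarrow> t \<le> t' \<Longrightarrow> 0 \<le> t * M + b * t\<^sup>2"
  shows "0 \<le> M"
proof (rule tendsto_lowerbound)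
  have "((\<lambda>t. M + b * t) \<longlongrightarrow> M + b * 0) (at_right 0)"
    by (intro tendsto_intros)
  then show "((\<lambda>t. M + b * t) \<longlongrightarrow> M) (at_right 0)"
    by simp
  have "0 \<le> M + b * t" if "0 < t" "t < t'" for t
  proof -
    have "0 \<le> t * (M + b * t)"
      using nonneg[of t] that by (simp add: algebra_simps power2_eq_square)
    with that show ?thesis by (simp add: zero_le_mult_iff)
  qed
  then show "\<forall>\<^sub>F t in at_right 0. 0 \<le> M + b * t"
    using \<open>t' > 0\<close> unfolding eventually_at_right_field by blast
qed simp

text \<open>The conclusion no longer mentions \<open>c\<close>; this is what allows the passage from
  the constant \<open>L\<close> to the constant 1.\<close>

lemma Max_gradient_nonneg_on_feasible_directions:
  fixes F :: "real ^ 'n \<Rightarrow> real ^ 'm"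
  assumes nonneg: "\<And>d. d \<in> displacements \<Omega> x \<Longrightarrow> 0 \<le> model F c x d"
    and "v \<in> feasible_directions \<Omega> x"
  shows "0 \<le> (MAX j. gradient (\<lambda>y. F y $ j) x \<bullet> v)"
proof -
  obtain t' where "t' > 0" and t': "\<And>t. 0 \<le> t \<Longrightarrow> t \<le> t' \<Longrightarrow> x + t *\<^sub>R v \<in> \<Omega>"
    using assms(2) unfolding feasible_directions_def by auto
  show ?thesis
  proof (rule nonneg_if_small_multiples_nonneg[OF \<open>t' > 0\<close>])
    fix t :: real assume t: "0 < t" "t \<le> t'"
    then have "0 \<le> model F c x (t *\<^sub>R v)"
      by (intro nonneg) (simp add: displacements_def t')
    with model_scaleR_le[of t F c x v] t
    show "0 \<le> t * (MAX j. gradient (\<lambda>y. F y $ j) x \<bullet> v) + (c / 2 * (norm v)\<^sup>2) * t\<^sup>2"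
      by (simp add: algebra_simps)
  qed
qed

theorem proposition1:
  fixes F :: "real ^ 'n \<Rightarrow> real ^ 'm" and s :: nat and L :: real and x :: "real ^ 'n"
  assumes "continuously_differentiable F"
    and "1 \<le> s" and "s < CARD('n)"
    and "L > 0"
    and "L_stationary F (sparse_set s) L x"
  shows "pareto_stationary F (sparse_set s) x"
proof -
  have x: "x \<in> sparse_set s" and "theta_L F (sparse_set s) L x = 0"
    using assms(5) by (auto simp: L_stationary_def)
  \<comment> \<open>An infimum of reals bounds the values from below only if they are bounded below;
    attainment of the minimum supplies this.\<close>
  then have "\<And>d. d \<in> displacements (sparse_set s) x \<Longrightarrow> 0 \<le> model F L x d"
    using theta_L_is_min[OF x \<open>L > 0\<close>, of F] by auto
  \<comment> \<open>Adding the nonnegative quadratic term to the nonnegative maximum keeps the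
    sign.\<close>
  then have "0 \<le> model F 1 x v" if "v \<in> feasible_directions (sparse_set s) x" for v
    using Max_gradient_nonneg_on_feasible_directions[of "sparse_set s" x F L v] that
    by (simp add: model_def)
  moreover have "0 \<in> feasible_directions (sparse_set s) x"
    using x by (auto simp: feasible_directions_def intro: exI[of _ 1])
  \<comment> \<open>The zero direction attains the lower bound 0.\<close>
  ultimately have "theta F (sparse_set s) x = 0"
    unfolding theta_def using INF_eq_attained[of 0 _ "model F 1 x"] by simp
  with x show ?thesis by (simp add: pareto_stationary_def)
qed

end
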